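(* Let $G$ be a graph such that $L_G^c=G[V(G)\setminus L(G)]$ is an almost-bipartite matching covered graph. Then $|\mathrm{corona}(G)|+|\mathrm{core}(G)|=2\alpha(G)+1$.
   Context: All graphs are finite, undirected and simple. $\alpha(G)$ is the maximum cardinality of an independent set of $G$, $\mu(G)$ the maximum cardinality of a matching, and $n(G)=|V(G)|$. $\Omega(G)$ is the set of maximum (i.e. maximum-cardinality) independent sets of $G$; $\mathrm{core}(G)=\bigcap_{S\in\Omega(G)}S$ and $\mathrm{corona}(G)=\bigcup_{S\in\Omega(G)}S$. For $X\subseteq V(G)$, $N(X)=\bigcup_{v\in X}N(v)$ and $d_G(X)=|X|-|N(X)|$. An independent set $X$ (possibly empty) is a critical independent set if $d_G(X)$ is maximum over all independent sets of $G$ (this maximum equals $\max_{X\subseteq V(G)}d_G(X)$); a maximum critical independent set is a critical independent set of maximum cardinality. A K\H{o}nig--Egerv\'ary graph is a graph with $\alpha(G)+\mu(G)=n(G)$. Larson's decomposition (known theorem defining $L(G)$): for any graph $G$ there is a unique set $L(G)\subseteq V(G)$ such that (1) $\alpha(G)=\alpha(G[L(G)])+\alpha(G[V(G)\setminus L(G)])$; (2) $G[L(G)]$ is a K\H{o}nig--Egerv\'ary graph; (3) for every non-empty independent set $I$ in the graph $G[V(G)\setminus L(G)]$, $|N(I)|>|I|$, with the neighborhood taken in $G[V(G)\setminus L(G)]$; (4) for every maximum critical independent set $J$ of $G$, $L(G)=J\cup N(J)$. Adding an ear to a graph $H$: take two vertices $u,v$ of $H$ and add a path from $u$ to $v$ all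 of whose vertices other than $u,v$ are new; the length of the ear is its number of edges. A graph $G$ is an almost-bipartite matching covered graph if there is a sequence of graphs $G_1,G_2,\dots,G_r,G_{r+1}=G$ such that $G_1=K_2$; $G_i$ is obtained from $G_{i-1}$ by adding an ear of odd length for $i=2,\dots,r$; $G_r$ is bipartite (and hence matching covered); and $G_{r+1}=G$ is obtained from $G_r$ by adding an ear $P$ of even length with $V(P)\cap V(G_r)=V(G_1)$ (so the ends of $P$ are the two vertices of $G_1$). A bipartite matching covered graph is a connected bipartite graph in which every edge belongs to a perfect matching. *)

theory Defs
  imports Main
begin

datatype 'a ugraph = UGraph (verts: "'a set") (edges: "'a set set")

definition simple_graph :: "'a ugraph \<Rightarrow> bool" where
  "simple_graph G \<longleftrightarrow>
     finite (verts G) \<and> (\<forall>e\<in>edges G. e \<subseteq> verts G \<and> card e = 2)"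

definition induced :: "'a ugraph \<Rightarrow> 'a set \<Rightarrow> 'a ugraph" where
  "induced G X = UGraph (verts G \<inter> X) {e \<in> edges G. e \<subseteq> X}"

definition neighbors :: "'a ugraph \<Rightarrow> 'a \<Rightarrow> 'a set" where
  "neighbors G v = {w. {v, w} \<in> edges G}"

definition neighborhood :: "'a ugraph \<Rightarrow> 'a set \<Rightarrow> 'a set" where
  "neighborhood G X = (\<Union>v\<in>X. neighbors G v)"

definition independent :: "'a ugraph \<Rightarrow> 'a set \<Rightarrow> bool" where
  "independent G S \<longleftrightarrow> S \<subseteq> verts G \<and> (\<forall>u\<in>S. \<forall>v\<in>S. {u, v} \<notin> edges G)"

definition matching :: "'a ugraph \<Rightarrow> 'a set set \<Rightarrow> bool" where
  "matching G M \<longleftrightarrow> M \<subseteq> edges G \<and> pairwise disjnt M"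

definition alpha :: "'a ugraph \<Rightarrow> nat" where
  "alpha G = Max (card ` {S. independent G S})"

definition mu :: "'a ugraph \<Rightarrow> nat" where
  "mu G = Max (card ` {M. matching G M})"

definition Omega :: "'a ugraph \<Rightarrow> 'a set set" where
  "Omega G = {S. independent G S \<and> card S = alpha G}"

definition core :: "'a ugraph \<Rightarrow> 'a set" where
  "core G = \<Inter> (Omega G)"

definition corona :: "'a ugraph \<Rightarrow> 'a set" where
  "corona G = \<Union> (Omega G)"

definition koenig_egervary :: "'a ugraph \<Rightarrow> bool" where
  "koenig_egervary G \<longleftrightarrow> alpha G + mu G = card (verts G)"

definition diff :: "'a ugraph \<Rightarrow> 'a set \<Rightarrow> int" where
  "diff G X = int (card X) - int (card (neighborhood G X))"

definition critical_independent :: "'a ugraph \<Rightarrow> 'a set \<Rightarrow> bool" where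
  "critical_independent G X \<longleftrightarrow>
     independent G X \<and> (\<forall>Y. independent G Y \<longrightarrow> diff G Y \<le> diff G X)"

definition max_critical_independent :: "'a ugraph \<Rightarrow> 'a set \<Rightarrow> bool" where
  "max_critical_independent G J \<longleftrightarrow>
     critical_independent G J \<and> (\<forall>K. critical_independent G K \<longrightarrow> card K \<le> card J)"

definition is_larson_set :: "'a ugraph \<Rightarrow> 'a set \<Rightarrow> bool" where
  "is_larson_set G L \<longleftrightarrow>
     L \<subseteq> verts G \<and>
     alpha G = alpha (induced G L) + alpha (induced G (verts G - L)) \<and>
     koenig_egervary (induced G L) \<and>
     (\<forall>I. independent (induced G (verts G - L)) I \<and> I \<noteq> {} \<longrightarrow>
        card (neighborhood (induced G (verts G - L)) I) > card I) \<and>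
     (\<forall>J. max_critical_independent G J \<longrightarrow> L = J \<union> neighborhood G J)"

text \<open>By Larson's decomposition theorem, every finite simple graph has exactly one
  set satisfying \<open>is_larson_set\<close>.\<close>

definition larson_set :: "'a ugraph \<Rightarrow> 'a set" where
  "larson_set G = (THE L. is_larson_set G L)"

definition is_K2 :: "'a ugraph \<Rightarrow> bool" where
  "is_K2 G \<longleftrightarrow> (\<exists>u v. u \<noteq> v \<and> G = UGraph {u, v} {{u, v}})"

definition bipartite :: "'a ugraph \<Rightarrow> bool" where
  "bipartite G \<longleftrightarrow>
     (\<exists>A B. A \<union> B = verts G \<and> A \<inter> B = {} \<and>
        (\<forall>e\<in>edges G. \<exists>a\<in>A. \<exists>b\<in>B. e = {a, b}))"

definition path_edges :: "'a list \<Rightarrow> 'a set set" where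
  "path_edges p = {{p ! i, p ! Suc i} | i. Suc i < length p}"

definition path_length :: "'a list \<Rightarrow> nat" where
  "path_length p = length p - 1"

text \<open>An ear is given by the list of all its vertices, both ends included. The last
  conjunct matters only for ears of length one: adding such an ear adds a new edge
  between two non-adjacent vertices, since graphs have no parallel edges.\<close>

definition is_ear :: "'a ugraph \<Rightarrow> 'a list \<Rightarrow> bool" where
  "is_ear H p \<longleftrightarrow>
     2 \<le> length p \<and> distinct p \<and> set p \<inter> verts H = {hd p, last p} \<and>
     path_edges p \<inter> edges H = {}"

definition add_ear :: "'a ugraph \<Rightarrow> 'a list \<Rightarrow> 'a ugraph" where
  "add_ear H p = UGraph (verts H \<union> set p) (edges H \<union> path_edges p)"

text \<open>\<open>odd_ear_sequence G1 H\<close>: the graph \<open>H\<close> arises from \<open>G1\<close> by successively adding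
  finitely many (possibly zero) ears of odd length.\<close>

inductive odd_ear_sequence :: "'a ugraph \<Rightarrow> 'a ugraph \<Rightarrow> bool" for G1 :: "'a ugraph" where
  start: "odd_ear_sequence G1 G1"
| step: "\<lbrakk>odd_ear_sequence G1 H; is_ear H p; odd (path_length p)\<rbrakk>
    \<Longrightarrow> odd_ear_sequence G1 (add_ear H p)"

definition almost_bipartite_matching_covered :: "'a ugraph \<Rightarrow> bool" where
  "almost_bipartite_matching_covered G \<longleftrightarrow>
     (\<exists>G1 Gr P. is_K2 G1 \<and> odd_ear_sequence G1 Gr \<and> bipartite Gr \<and>
        is_ear Gr P \<and> even (path_length P) \<and> set P \<inter> verts Gr = verts G1 \<and>
        G = add_ear Gr P)"

end

theory Submission
  imports Defs
begin

text \<open>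
  Let \<open>J\<close> be a maximum critical independent set, \<open>N\<close> its neighborhood, and \<open>H\<close> the graph
  that is left after deleting \<open>J \<union> N\<close>. The excess \<open>\<bar>corona\<bar> + \<bar>core\<bar> - 2\<alpha>\<close> of \<open>G\<close> turns out to
  be that of \<open>H\<close>, and for an almost-bipartite matching covered \<open>H\<close> the excess is \<open>1\<close>.

  Since \<open>larson_set\<close> is a definite description, it has to be shown that \<open>J \<union> N\<close> meets Larson's
  conditions and does not depend on \<open>J\<close>. Both rest on two facts about critical sets: the
  function \<open>diff\<close> is supermodular, and by Hall's theorem there is a matching \<open>m\<close> of \<open>N\<close> into \<open>J\<close>
  (a subset of \<open>N\<close> violating Hall's condition could be traded for a set of larger \<open>diff\<close>).
  Independence of the choice of \<open>J\<close> is \<open>max_critical_closure_subset\<close>.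

  The excess is transferred in \<open>corona_core_larson\<close>. A maximum independent set \<open>S\<close> of \<open>G\<close> restricts
  to a maximum one of \<open>H\<close> and has exactly \<open>\<bar>J\<bar>\<close> elements in \<open>J \<union> N\<close>; as \<open>S\<close> contains at most one
  end of each edge of \<open>m\<close>, this forces \<open>J - S = m ` (S \<inter> N)\<close>. Taking the union over all \<open>S\<close> gives
  \<open>J - core G = m ` (corona G \<inter> N)\<close>. Moreover \<open>J \<subseteq> corona G\<close> and \<open>core G \<inter> N = {}\<close>, because \<open>J\<close>
  together with any maximum independent set of \<open>H\<close> is a maximum independent set of \<open>G\<close>. So each
  vertex of \<open>N\<close> that enters the corona removes one vertex of \<open>J\<close> from the core, and the part inside
  \<open>J \<union> N\<close> contributes \<open>2\<bar>J\<bar>\<close> in total.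

  For \<open>H\<close> itself (\<open>almost_bipartite_matching_covered_Omega\<close>), odd ears have an even number of inner
  vertices, so the bipartite part \<open>F\<close>, with sides \<open>A\<close> and \<open>B\<close>, has a perfect matching through the
  initial edge \<open>uv\<close>. The last ear closes \<open>uv\<close> to an odd cycle of length \<open>2k + 1\<close>, hence \<open>H\<close> is covered
  by an odd cycle and disjoint edges, and \<open>\<alpha>(H) \<le> \<bar>A\<bar> - 1 + k\<close>. Three sets attain this bound: each of
  \<open>A\<close> and \<open>B\<close> together with the inner ear vertices at even positions, and \<open>A - {u, v}\<close> together with
  the ear vertices at odd positions. They cover \<open>H\<close> and have no vertex in common, so the corona of
  \<open>H\<close> is everything, \<open>2\<bar>A\<bar> + 2k - 1\<close> vertices, and its core is empty.
\<close>

section \<open>Hall's marriage theorem\<close>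

text \<open>The Halmos--Vaughan induction. If some proper nonempty subfamily \<open>K\<close> is tight, it must use up
  its whole union, so \<open>K\<close> and the remaining family with that union removed are solved separately.
  If none is tight, any representative may be fixed for one index, since deleting it costs every
  other subfamily at most its spare element.\<close>

theorem hall_marriage:
  assumes "finite I" "\<And>i. i \<in> I \<Longrightarrow> finite (A i)"
    and "\<And>K. K \<subseteq> I \<Longrightarrow> card K \<le> card (\<Union>i\<in>K. A i)"
  shows "\<exists>f. inj_on f I \<and> (\<forall>i\<in>I. f i \<in> A i)"
  using assms
proof (induction "card I" arbitrary: I A rule: less_induct)
  case less
  note fin = less.prems(1) and finA = less.prems(2) and hall = less.prems(3)
  show ?case
  proof (cases "I = {}")
    case True
    then show ?thesis by simp
  next
    case False
    then obtain i where i: "i \<in> I" by blast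
    show ?thesis
    proof (cases "\<exists>K. K \<subset> I \<and> K \<noteq> {} \<and> card K = card (\<Union>i\<in>K. A i)")
      case True
      then obtain K where K: "K \<subset> I" "K \<noteq> {}" "card K = card (\<Union>i\<in>K. A i)" by blast
      let ?U = "\<Union>i\<in>K. A i"
      have finK: "finite K" using K fin finite_subset by blast
      have finU: "finite ?U" using finK K finA by blast
      have "card K < card I" using K fin psubset_card_mono by blast
      moreover have "card Q \<le> card (\<Union>i\<in>Q. A i)" if "Q \<subseteq> K" for Q
        using that K by (intro hall) auto
      ultimately have "\<exists>f. inj_on f K \<and> (\<forall>i\<in>K. f i \<in> A i)"
        using K finK finA by (intro less.hyps) auto
      then obtain f where f: "inj_on f K" "\<forall>i\<in>K. f i \<in> A i" by blast
      have less': "card (I - K) < card I"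
        using K fin by (intro psubset_card_mono) auto
      have hall': "card Q \<le> card (\<Union>i\<in>Q. A i - ?U)" if Q: "Q \<subseteq> I - K" for Q
      proof -
        have finQ: "finite Q" using Q fin finite_subset by blast
        have "card Q + card K = card (Q \<union> K)"
          using Q finQ finK by (subst card_Un_disjoint) auto
        also have "\<dots> \<le> card (\<Union>i\<in>Q \<union> K. A i)" using Q K by (intro hall) auto
        also have "(\<Union>i\<in>Q \<union> K. A i) = (\<Union>i\<in>Q. A i - ?U) \<union> ?U" by auto
        also have "card \<dots> = card (\<Union>i\<in>Q. A i - ?U) + card ?U"
          using finQ Q finA finU by (intro card_Un_disjoint) auto
        finally show ?thesis using K(3) by simp
      qed
      have "\<exists>g. inj_on g (I - K) \<and> (\<forall>i\<in>I - K. g i \<in> A i - ?U)"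
        using fin finA by (intro less.hyps[OF less'] hall') auto
      then obtain g where g: "inj_on g (I - K)" "\<forall>i\<in>I - K. g i \<in> A i - ?U" by blast
      let ?h = "\<lambda>i. if i \<in> K then f i else g i"
      have "inj_on ?h I"
      proof (rule inj_onI)
        fix x y assume xy: "x \<in> I" "y \<in> I" "?h x = ?h y"
        show "x = y"
        proof (cases "x \<in> K"; cases "y \<in> K")
          assume "x \<in> K" "y \<in> K"
          then show ?thesis using xy f(1) by (auto dest: inj_onD)
        next
          assume "x \<notin> K" "y \<notin> K"
          then show ?thesis using xy g(1) by (auto dest: inj_onD)
        next
          assume "x \<in> K" "y \<notin> K"
          then have "f x \<in> ?U" "f x = g y" "g y \<notin> ?U" using xy f(2) bspec[OF g(2), of y] by auto
          then show ?thesis by simp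
        next
          assume "x \<notin> K" "y \<in> K"
          then have "f y \<in> ?U" "f y = g x" "g x \<notin> ?U" using xy f(2) bspec[OF g(2), of x] by auto
          then show ?thesis by simp
        qed
      qed
      moreover have "\<forall>i\<in>I. ?h i \<in> A i" using f(2) g(2) by auto
      ultimately show ?thesis by blast
    next
      case False
      have "card {i} \<le> card (\<Union>i\<in>{i}. A i)" using i by (intro hall) auto
      then have "A i \<noteq> {}" by auto
      then obtain x where x: "x \<in> A i" by blast
      have hall': "card Q \<le> card (\<Union>j\<in>Q. A j - {x})" if Q: "Q \<subseteq> I - {i}" for Q
      proof (cases "Q = {}")
        case False
        have finQ: "finite Q" using Q fin finite_subset by blast
        have "Q \<subset> I" using Q i by blast
        then have "card Q \<noteq> card (\<Union>j\<in>Q. A j)"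
          using \<open>Q \<noteq> {}\<close> \<open>\<not> (\<exists>K. _ K)\<close> by blast
        moreover have "card Q \<le> card (\<Union>j\<in>Q. A j)" using Q by (intro hall) auto
        moreover have "(\<Union>j\<in>Q. A j - {x}) = (\<Union>j\<in>Q. A j) - {x}" by auto
        moreover have "card (\<Union>j\<in>Q. A j) \<le> Suc (card ((\<Union>j\<in>Q. A j) - {x}))"
          by (cases "x \<in> (\<Union>j\<in>Q. A j)") (auto simp: card_Diff_singleton_if)
        ultimately show ?thesis by simp
      qed simp
      have "card (I - {i}) < card I" using i fin by (meson card_Diff1_less)
      then have "\<exists>g. inj_on g (I - {i}) \<and> (\<forall>j\<in>I - {i}. g j \<in> A j - {x})"
        using fin finA by (intro less.hyps hall') auto
      then obtain g where g: "inj_on g (I - {i})" "\<forall>j\<in>I - {i}. g j \<in> A j - {x}" by blast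
      have "inj_on (g(i := x)) I"
        using g by (auto simp: inj_on_def)
      moreover have "\<forall>j\<in>I. (g(i := x)) j \<in> A j" using g x by auto
      ultimately show ?thesis by blast
    qed
  qed
qed

section \<open>Neighborhoods and independent sets\<close>

lemma mem_neighborhood: "w \<in> neighborhood G X \<longleftrightarrow> (\<exists>v\<in>X. {v, w} \<in> edges G)"
  by (auto simp: neighborhood_def neighbors_def)

lemma neighborhood_Un: "neighborhood G (X \<union> Y) = neighborhood G X \<union> neighborhood G Y"
  by (auto simp: mem_neighborhood)

lemma neighborhood_mono: "X \<subseteq> Y \<Longrightarrow> neighborhood G X \<subseteq> neighborhood G Y"
  by (auto simp: neighborhood_def)

lemma independent_iff_neighborhood:
  "independent G S \<longleftrightarrow> S \<subseteq> verts G \<and> S \<inter> neighborhood G S = {}"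
  unfolding independent_def disjoint_iff mem_neighborhood by blast

text \<open>Symmetry of adjacency, in the set form in which it is used throughout.\<close>

lemma neighborhood_disjoint_commute:
  fixes G :: "'a ugraph"
  shows
  "X \<inter> neighborhood G Y = {} \<longleftrightarrow> Y \<inter> neighborhood G X = {}"
proof -
  have "Y \<inter> neighborhood G X = {}" if "X \<inter> neighborhood G Y = {}" for X Y :: "'a set"
  proof (rule ccontr)
    assume "\<not> ?thesis"
    then obtain x y where "x \<in> X" "y \<in> Y" "{x, y} \<in> edges G"
      unfolding disjoint_iff mem_neighborhood by blast
    then have "x \<in> X \<inter> neighborhood G Y"
      unfolding Int_iff mem_neighborhood by (metis insert_commute)
    then show False using that by blast
  qed
  then show ?thesis by blast
qed

lemma independent_induced:
  "independent (induced G X) S \<longleftrightarrow> independent G S \<and> S \<subseteq> X"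
proof (cases "S \<subseteq> X")
  case True
  then have "{u, v} \<subseteq> X" if "u \<in> S" "v \<in> S" for u v using that by blast
  then show ?thesis using True by (simp add: independent_def induced_def)
qed (simp add: independent_def induced_def)

lemma neighborhood_induced:
  "I \<subseteq> X \<Longrightarrow> neighborhood (induced G X) I = neighborhood G I \<inter> X"
  unfolding set_eq_iff Int_iff mem_neighborhood by (simp add: induced_def) blast

lemma independent_subset: "independent G S \<Longrightarrow> T \<subseteq> S \<Longrightarrow> independent G T"
  by (auto simp: independent_def)

lemma simple_graph_induced: "simple_graph G \<Longrightarrow> simple_graph (induced G X)"
  by (auto simp: simple_graph_def induced_def)

lemma verts_induced [simp]: "verts (induced G X) = verts G \<inter> X"
  by (simp add: induced_def)

locale finite_simple_graph =
  fixes G :: "'a ugraph"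
  assumes simple: "simple_graph G"
begin

lemma finite_verts: "finite (verts G)"
  using simple by (simp add: simple_graph_def)

lemma neighborhood_subset_verts: "neighborhood G X \<subseteq> verts G"
  using simple unfolding simple_graph_def subset_iff mem_neighborhood by blast

lemma finite_neighborhood: "finite (neighborhood G X)"
  using finite_subset[OF neighborhood_subset_verts finite_verts] .

lemma finite_independent: "independent G S \<Longrightarrow> finite S"
  using finite_verts finite_subset by (auto simp: independent_def)

lemma independent_empty: "independent G {}"
  by (simp add: independent_def)

lemma finite_independents: "finite {S. independent G S}"
  using finite_verts by (auto simp: independent_def intro: finite_subset[of _ "Pow (verts G)"])

lemma card_le_alpha: "independent G S \<Longrightarrow> card S \<le> alpha G"
  unfolding alpha_def using finite_independents by (intro Max_ge) auto

lemma Omega_nonempty: "\<exists>S. S \<in> Omega G"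
proof -
  have "alpha G \<in> card ` {S. independent G S}"
    unfolding alpha_def using finite_independents independent_empty by (intro Max_in) auto
  then show ?thesis by (auto simp: Omega_def)
qed

lemma alpha_eqI:
  assumes "independent G S" "\<And>T. independent G T \<Longrightarrow> card T \<le> card S"
  shows "alpha G = card S"
proof (rule antisym)
  obtain T where "independent G T" "card T = alpha G"
    using Omega_nonempty by (auto simp: Omega_def)
  then show "alpha G \<le> card S" using assms(2) by metis
qed (rule card_le_alpha[OF assms(1)])

lemma finite_matchings: "finite {M. matching G M}"
proof -
  have "finite (edges G)"
    using simple by (intro finite_subset[of "edges G" "Pow (verts G)"]) (auto simp: simple_graph_def)
  then show ?thesis
    by (auto simp: matching_def intro: finite_subset[of _ "Pow (edges G)"])
qed

text \<open>Every matching edge has an end outside \<open>S\<close>, and these ends are distinct.\<close>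

lemma independent_matching_bound:
  assumes "independent G S" "matching G M"
  shows "card S + card M \<le> card (verts G)"
proof -
  have "\<exists>x. x \<in> e - S" if "e \<in> M" for e
  proof -
    have e: "e \<in> edges G" using that assms(2) by (auto simp: matching_def)
    then obtain u v where "e = {u, v}"
      using simple by (auto simp: simple_graph_def card_2_iff)
    then show ?thesis using e assms(1) by (auto simp: independent_def)
  qed
  then obtain f where f: "\<And>e. e \<in> M \<Longrightarrow> f e \<in> e - S" by metis
  have "inj_on f M"
  proof (rule inj_onI, rule ccontr)
    fix d e assume "d \<in> M" "e \<in> M" "f d = f e" "d \<noteq> e"
    then show False
      using f[of d] f[of e] assms(2) by (auto simp: matching_def disjnt_iff dest: pairwiseD)
  qed
  moreover have "f ` M \<subseteq> verts G - S"
    using f assms(2) simple by (fastforce simp: matching_def simple_graph_def)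
  ultimately have "card M \<le> card (verts G - S)"
    using finite_verts by (meson card_inj_on_le finite_Diff)
  then show ?thesis
    using assms(1) finite_verts card_mono[of "verts G" S]
    by (auto simp: independent_def card_Diff_subset finite_subset)
qed

lemma independent_iff_edges:
  "independent G S \<longleftrightarrow> S \<subseteq> verts G \<and> (\<forall>e\<in>edges G. \<not> e \<subseteq> S)"
proof -
  have "\<exists>u v. e = {u, v}" if "e \<in> edges G" for e
  proof -
    have "card e = 2" using simple that by (simp add: simple_graph_def)
    then show ?thesis unfolding card_2_iff by blast
  qed
  then have "(\<forall>e\<in>edges G. \<not> e \<subseteq> S) \<longleftrightarrow> (\<forall>u\<in>S. \<forall>v\<in>S. {u, v} \<notin> edges G)"
    by (metis empty_subsetI insert_subset)
  then show ?thesis by (simp add: independent_def)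
qed

section \<open>Critical independent sets\<close>

lemma diff_supermodular:
  assumes "X \<subseteq> verts G" "Y \<subseteq> verts G"
  shows "diff G X + diff G Y \<le> diff G (X \<union> Y) + diff G (X \<inter> Y)"
proof -
  have fin: "finite X" "finite Y" using assms finite_verts finite_subset by blast+
  have "card (neighborhood G (X \<inter> Y)) \<le> card (neighborhood G X \<inter> neighborhood G Y)"
    using finite_neighborhood by (intro card_mono) (auto simp: mem_neighborhood)
  then show ?thesis
    using card_Un_Int[OF fin] card_Un_Int[OF finite_neighborhood finite_neighborhood, of X Y]
    by (simp add: diff_def neighborhood_Un)
qed

lemma independent_Diff_neighborhood:
  assumes "X \<subseteq> verts G"
  shows "independent G (X - neighborhood G X)"
  using assms by (auto simp: independent_def mem_neighborhood)

text \<open>Removing from \<open>X\<close> the vertices that have a neighbor in \<open>X\<close> also removes all of \<open>X\<close>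
  from the neighborhood, so \<open>diff\<close> does not drop. Consequently the maximum of \<open>diff\<close> over independent sets is its maximum over
  all sets of vertices, which makes supermodularity applicable to critical independent sets.\<close>

lemma diff_le_diff_independent:
  assumes "X \<subseteq> verts G"
  shows "diff G X \<le> diff G (X - neighborhood G X)"
proof -
  let ?N = "neighborhood G X"
  have fin: "finite X" using assms finite_verts finite_subset by blast
  have "X \<inter> neighborhood G (X - ?N) = {}" by (subst neighborhood_disjoint_commute) auto
  then have "neighborhood G (X - ?N) \<subseteq> ?N - X" using neighborhood_mono[of "X - ?N" X G] by blast
  then have "card (neighborhood G (X - ?N)) \<le> card (?N - X)"
    using finite_neighborhood by (intro card_mono) auto
  moreover have "card (?N - X) + card (?N \<inter> X) = card ?N"
    using finite_neighborhood by (metis add.commute card_Int_Diff)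
  moreover have "card (X - ?N) + card (X \<inter> ?N) = card X"
    using fin by (metis add.commute card_Int_Diff)
  ultimately show ?thesis by (simp add: diff_def Int_commute)
qed

lemma critical_diff_max:
  assumes "critical_independent G J" "X \<subseteq> verts G"
  shows "diff G X \<le> diff G J"
  using order_trans[OF diff_le_diff_independent[OF assms(2)]] assms(1)
    independent_Diff_neighborhood[OF assms(2)]
  by (simp add: critical_independent_def)

text \<open>Deleting from \<open>J\<close> the neighbors of \<open>T\<close> removes all of \<open>T\<close> from the neighborhood of \<open>J\<close>; were \<open>T\<close>
  larger than its neighborhood in \<open>J\<close>, this would increase \<open>diff\<close>.\<close>

lemma critical_hall_condition:
  assumes "critical_independent G J" "T \<subseteq> neighborhood G J"
  shows "card T \<le> card (neighborhood G T \<inter> J)"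
proof -
  let ?J' = "J - neighborhood G T"
  have J: "independent G J" using assms by (simp add: critical_independent_def)
  have fin: "finite J" using finite_independent[OF J] .
  have "diff G ?J' \<le> diff G J"
    using assms(1) J by (intro critical_diff_max) (auto simp: independent_def)
  moreover have "card (neighborhood G ?J') \<le> card (neighborhood G J - T)"
  proof (rule card_mono)
    have "T \<inter> neighborhood G ?J' = {}" by (subst neighborhood_disjoint_commute) auto
    then show "neighborhood G ?J' \<subseteq> neighborhood G J - T"
      using neighborhood_mono[of ?J' J G] by blast
  qed (simp add: finite_neighborhood)
  moreover have "card (neighborhood G J - T) + card T = card (neighborhood G J)"
    using assms(2) finite_neighborhood
    by (metis card_Diff_subset card_mono finite_subset le_add_diff_inverse2)
  moreover have "card ?J' + card (J \<inter> neighborhood G T) = card J"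
    using fin by (metis add.commute card_Int_Diff)
  ultimately show ?thesis by (simp add: diff_def Int_commute)
qed

lemma critical_matching_into:
  assumes "critical_independent G J"
  obtains m where "inj_on m (neighborhood G J)" "m ` neighborhood G J \<subseteq> J"
    "\<And>b. b \<in> neighborhood G J \<Longrightarrow> {b, m b} \<in> edges G"
proof -
  have fin: "finite J" using assms finite_independent by (simp add: critical_independent_def)
  have "\<exists>m. inj_on m (neighborhood G J) \<and> (\<forall>b\<in>neighborhood G J. m b \<in> neighbors G b \<inter> J)"
  proof (rule hall_marriage)
    fix K assume "K \<subseteq> neighborhood G J"
    then have "card K \<le> card (neighborhood G K \<inter> J)"
      by (rule critical_hall_condition[OF assms])
    also have "neighborhood G K \<inter> J = (\<Union>b\<in>K. neighbors G b \<inter> J)"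
      by (auto simp: neighborhood_def)
    finally show "card K \<le> card (\<Union>b\<in>K. neighbors G b \<inter> J)" .
  qed (use fin finite_neighborhood in auto)
  then show thesis using that by (auto simp: neighbors_def)
qed

lemma max_critical_exists: "\<exists>J. max_critical_independent G J"
proof -
  let ?I = "{S. independent G S}"
  obtain K where K: "critical_independent G K"
  proof -
    have "Max (diff G ` ?I) \<in> diff G ` ?I"
      using finite_independents independent_empty by (intro Max_in) auto
    then obtain K where "independent G K" "diff G K = Max (diff G ` ?I)" by auto
    moreover have "diff G S \<le> Max (diff G ` ?I)" if "independent G S" for S
      using finite_independents that by (intro Max_ge) auto
    ultimately show thesis by (intro that[of K]) (simp add: critical_independent_def)
  qed
  have fin: "finite {K. critical_independent G K}"
    by (rule finite_subset[OF _ finite_independents]) (auto simp: critical_independent_def)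
  have "Max (card ` {K. critical_independent G K}) \<in> card ` {K. critical_independent G K}"
    using fin K by (intro Max_in) auto
  then obtain J where "critical_independent G J"
    "card J = Max (card ` {K. critical_independent G K})" by auto
  then show ?thesis using fin by (auto simp: max_critical_independent_def)
qed

section \<open>Larson's decomposition\<close>

text \<open>With \<open>A = J' \<inter> N(J)\<close> and \<open>B = J \<inter> N(J')\<close>, Hall's condition for \<open>J\<close> and for \<open>J'\<close> gives \<open>\<bar>A\<bar> = \<bar>B\<bar>\<close>.
  By supermodularity \<open>J \<union> J'\<close> attains the maximum of \<open>diff\<close>. Removing \<open>A\<close> from it leaves the
  independent set \<open>K = J \<union> (J' - N(J))\<close>, whose neighborhood avoids \<open>B\<close>; thus \<open>K\<close> is still critical,
  and maximality of \<open>J\<close> yields \<open>K = J\<close>, so that \<open>J' \<subseteq> J \<union> N(J)\<close>. Comparing \<open>diff (J \<union> J')\<close> with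
  \<open>diff J\<close> then shows that \<open>N(J') - N(J)\<close> has only \<open>\<bar>B\<bar>\<close> elements, hence equals \<open>B \<subseteq> J\<close>.\<close>

lemma max_critical_closure_subset:
  assumes J: "max_critical_independent G J" and J': "max_critical_independent G J'"
  shows "J' \<union> neighborhood G J' \<subseteq> J \<union> neighborhood G J"
proof -
  let ?N = "neighborhood G"
  define A where "A = J' \<inter> ?N J"
  define B where "B = J \<inter> ?N J'"
  define X where "X = J \<union> J'"
  define K where "K = X - A"
  have crit: "critical_independent G J" "critical_independent G J'"
    using J J' by (auto simp: max_critical_independent_def)
  then have ind: "independent G J" "independent G J'" by (auto simp: critical_independent_def)
  then have sub: "J \<subseteq> verts G" "J' \<subseteq> verts G" and disj: "J \<inter> ?N J = {}" "J' \<inter> ?N J' = {}"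
    by (auto simp: independent_iff_neighborhood)
  have fin: "finite J" "finite J'" using ind finite_independent by auto
  have dJ: "diff G J = diff G J'"
    using critical_diff_max crit sub by (meson antisym)
  have X: "diff G X = diff G J"
    using diff_supermodular[OF sub] critical_diff_max[OF crit(1), of X]
      critical_diff_max[OF crit(1), of "J \<inter> J'"] sub dJ unfolding X_def by force
  have "card A \<le> card (?N A \<inter> J)"
    using critical_hall_condition[OF crit(1), of A] by (auto simp: A_def)
  also have "\<dots> \<le> card B"
    using fin neighborhood_mono[of A J' G] by (intro card_mono) (auto simp: A_def B_def)
  finally have AB: "card A \<le> card B" .
  have "card B \<le> card (?N B \<inter> J')"
    using critical_hall_condition[OF crit(2), of B] by (auto simp: B_def)
  also have "\<dots> \<le> card A"
    using fin neighborhood_mono[of B J G] by (intro card_mono) (auto simp: A_def B_def)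
  finally have AB: "card A = card B" using AB by simp
  have finAB: "finite A" "finite B" using fin by (auto simp: A_def B_def)
  have K_eq: "K = J \<union> (J' - ?N J)" using disj by (auto simp: K_def X_def A_def)
  have indK: "independent G K"
  proof -
    have "J \<inter> ?N (J' - ?N J) = {}" by (subst neighborhood_disjoint_commute) auto
    moreover have "?N (J' - ?N J) \<subseteq> ?N J'" by (rule neighborhood_mono) auto
    ultimately show ?thesis
      using sub disj unfolding independent_iff_neighborhood K_eq neighborhood_Un by blast
  qed
  have "?N K \<subseteq> ?N X - B"
  proof -
    have "K \<subseteq> X" by (simp add: K_def)
    moreover have "B \<inter> ?N K = {}"
      using indK K_eq by (auto simp: B_def independent_iff_neighborhood)
    ultimately show ?thesis using neighborhood_mono[of K X G] by blast
  qed
  then have "card (?N K) \<le> card (?N X - B)"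
    using finite_neighborhood by (intro card_mono) auto
  moreover have "B \<subseteq> ?N X" by (auto simp: B_def X_def neighborhood_Un)
  then have "card (?N X - B) + card B = card (?N X)"
    using finite_neighborhood finAB by (metis card_Diff_subset card_mono le_add_diff_inverse2)
  moreover have "card K + card A = card X"
    using fin finAB unfolding K_def
    by (metis A_def X_def Un_upper2 card_Diff_subset card_mono finite_UnI inf.coboundedI1 le_add_diff_inverse2)
  ultimately have "diff G X \<le> diff G K" using AB by (simp add: diff_def)
  then have "critical_independent G K"
    using indK crit(1) X by (force simp: critical_independent_def)
  then have "card K \<le> card J" using J by (simp add: max_critical_independent_def)
  moreover have "J \<subseteq> K" "finite K" using fin by (auto simp: K_eq)
  ultimately have KJ: "K = J" by (metis card_seteq)
  have sub1: "J' \<subseteq> J \<union> ?N J" using KJ K_eq by auto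
  have "X = J \<union> A" "J \<inter> A = {}" using sub1 disj by (auto simp: X_def A_def)
  then have "card X = card J + card A" using fin finAB by (simp add: card_Un_disjoint)
  moreover have "card (?N X) = card (?N J) + card (?N J' - ?N J)"
    unfolding X_def neighborhood_Un
    by (subst card_Un_disjoint[symmetric]) (auto simp: finite_neighborhood)
  ultimately have "card (?N J' - ?N J) = card B" using X AB by (simp add: diff_def)
  moreover have "B \<subseteq> ?N J' - ?N J" using disj by (auto simp: B_def)
  ultimately have "B = ?N J' - ?N J"
    using finite_neighborhood by (intro card_subset_eq) auto
  then have "?N J' \<subseteq> J \<union> ?N J" by (auto simp: B_def)
  then show ?thesis using sub1 by blast
qed

text \<open>\<open>J\<close> and a matching that saturates \<open>N(J)\<close> have \<open>\<bar>J \<union> N(J)\<bar>\<close> elements together, so both are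
  optimal.\<close>

lemma alpha_critical_closure:
  assumes "critical_independent G J"
  shows "alpha (induced G (J \<union> neighborhood G J)) = card J" (is ?a)
    and "koenig_egervary (induced G (J \<union> neighborhood G J))" (is ?k)
proof -
  let ?N = "neighborhood G J"
  let ?H = "induced G (J \<union> ?N)"
  have J: "independent G J" using assms by (simp add: critical_independent_def)
  then have sub: "J \<subseteq> verts G" and disj: "J \<inter> ?N = {}"
    by (auto simp: independent_iff_neighborhood)
  have fin: "finite J" using finite_independent[OF J] .
  interpret H: finite_simple_graph ?H by unfold_locales (rule simple_graph_induced[OF simple])
  obtain m where m: "inj_on m ?N" "m ` ?N \<subseteq> J" "\<And>b. b \<in> ?N \<Longrightarrow> {b, m b} \<in> edges G"
    using critical_matching_into[OF assms] by metis
  define M where "M = (\<lambda>b. {b, m b}) ` ?N"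
  have "inj_on (\<lambda>b. {b, m b}) ?N"
    using m(2) disj by (auto simp: inj_on_def doubleton_eq_iff)
  then have cM: "card M = card ?N" by (simp add: M_def card_image)
  have M: "matching ?H M"
    unfolding matching_def
  proof
    show "M \<subseteq> edges ?H" using m by (auto simp: M_def induced_def)
    show "pairwise disjnt M"
      unfolding M_def pairwise_image
    proof (rule pairwiseI, intro impI)
      fix b c assume "b \<in> ?N" "c \<in> ?N" "b \<noteq> c"
      moreover from this have "m b \<noteq> m c" "m b \<in> J" "m c \<in> J"
        using m(1,2) by (auto dest: inj_onD)
      ultimately show "disjnt {b, m b} {c, m c}" using disj by (auto simp: disjnt_def)
    qed
  qed
  have "verts ?H = J \<union> ?N" using sub neighborhood_subset_verts by auto
  then have cH: "card (verts ?H) = card J + card ?N"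
    using fin finite_neighborhood disj by (simp add: card_Un_disjoint)
  have JH: "independent ?H J" using J by (auto simp: independent_induced)
  show a: ?a
    using H.independent_matching_bound[OF _ M] cM cH by (intro H.alpha_eqI[OF JH]) force
  have "mu ?H = card ?N"
    unfolding mu_def
  proof (rule Max_eqI)
    fix k assume "k \<in> card ` {M. matching ?H M}"
    then show "k \<le> card ?N"
      using H.independent_matching_bound[OF JH] cH by auto
  qed (use H.finite_matchings M cM in \<open>auto intro: rev_image_eqI\<close>)
  then show ?k using a cH by (simp add: koenig_egervary_def)
qed

lemma independent_Un_outside:
  assumes "independent G J" "independent G I" "I \<subseteq> verts G - (J \<union> neighborhood G J)"
  shows "independent G (J \<union> I)"
proof -
  have "I \<inter> neighborhood G J = {}" using assms(3) by auto
  then have "J \<inter> neighborhood G I = {}" by (subst neighborhood_disjoint_commute)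
  then show ?thesis
    using assms \<open>I \<inter> neighborhood G J = {}\<close>
    unfolding independent_iff_neighborhood neighborhood_Un by blast
qed

lemma alpha_critical_split:
  assumes "critical_independent G J"
  defines "L \<equiv> J \<union> neighborhood G J"
  shows "alpha G = card J + alpha (induced G (verts G - L))"
proof -
  let ?H = "induced G (verts G - L)"
  have J: "independent G J" using assms by (simp add: critical_independent_def)
  interpret L: finite_simple_graph "induced G L" by unfold_locales (rule simple_graph_induced[OF simple])
  interpret H: finite_simple_graph ?H by unfold_locales (rule simple_graph_induced[OF simple])
  obtain T where "T \<in> Omega ?H" using H.Omega_nonempty by blast
  then have T: "independent G T" "T \<subseteq> verts G - L" "card T = alpha ?H"
    by (auto simp: Omega_def independent_induced)
  have ind: "independent G (J \<union> T)"
    using independent_Un_outside[OF J T(1)] T(2) unfolding L_def .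
  have cJT: "card (J \<union> T) = card J + alpha ?H"
    using T J finite_independent by (subst card_Un_disjoint) (auto simp: L_def)
  have "card S \<le> card (J \<union> T)" if S: "independent G S" for S
  proof -
    have "card (S \<inter> L) \<le> alpha (induced G L)"
      using S by (intro L.card_le_alpha) (auto simp: independent_induced intro: independent_subset)
    then have "card (S \<inter> L) \<le> card J" using alpha_critical_closure(1)[OF assms(1)] by (simp add: L_def)
    moreover have "card (S - L) \<le> alpha ?H"
      using S independent_iff_neighborhood[of G S]
      by (intro H.card_le_alpha) (auto simp: independent_induced intro: independent_subset)
    moreover have "card S = card (S \<inter> L) + card (S - L)"
      using finite_independent[OF S] by (simp add: card_Int_Diff)
    ultimately show ?thesis using cJT by simp
  qed
  then show ?thesis using alpha_eqI[OF ind] cJT by simp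
qed

text \<open>A nonempty independent set \<open>I\<close> outside the closure of \<open>J\<close> with at most \<open>\<bar>I\<bar>\<close> neighbors there could
  be added to \<open>J\<close>, contradicting the maximality of \<open>J\<close> among the critical sets.\<close>

lemma is_larson_set_closure:
  assumes "max_critical_independent G J"
  shows "is_larson_set G (J \<union> neighborhood G J)"
proof -
  let ?N = "neighborhood G"
  let ?L = "J \<union> ?N J"
  let ?H = "induced G (verts G - ?L)"
  have crit: "critical_independent G J" using assms by (simp add: max_critical_independent_def)
  then have J: "independent G J" by (simp add: critical_independent_def)
  have sub: "?L \<subseteq> verts G" using J neighborhood_subset_verts by (auto simp: independent_def)
  have "card I < card (neighborhood ?H I)" if I: "independent ?H I" "I \<noteq> {}" for I
  proof (rule ccontr)
    assume neg: "\<not> ?thesis"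
    have I': "independent G I" "I \<subseteq> verts G - ?L" using I by (auto simp: independent_induced)
    have fin: "finite I" "finite J" using I' J finite_independent by auto
    have ind: "independent G (J \<union> I)" using independent_Un_outside[OF J I'] .
    have "I \<inter> ?N J = {}" using I' by auto
    then have "J \<inter> ?N I = {}" by (subst neighborhood_disjoint_commute)
    then have "?N (J \<union> I) = ?N J \<union> neighborhood ?H I"
      using neighborhood_subset_verts neighborhood_induced[OF I'(2)] by (auto simp: neighborhood_Un)
    then have "card (?N (J \<union> I)) \<le> card (?N J) + card I"
      using neg card_Un_le[of "?N J" "neighborhood ?H I"] by simp
    moreover have card: "card (J \<union> I) = card J + card I"
      using fin I' by (intro card_Un_disjoint) auto
    ultimately have "diff G J \<le> diff G (J \<union> I)" by (simp add: diff_def)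
    then have "critical_independent G (J \<union> I)"
      using ind crit by (force simp: critical_independent_def)
    then have "card (J \<union> I) \<le> card J" using assms by (simp add: max_critical_independent_def)
    then show False using card fin I(2) by (simp add: card_eq_0_iff)
  qed
  moreover have "?L = J' \<union> ?N J'" if "max_critical_independent G J'" for J'
    using max_critical_closure_subset assms that by (meson subset_antisym)
  ultimately show ?thesis
    unfolding is_larson_set_def
    using sub alpha_critical_closure[OF crit] alpha_critical_split[OF crit] by auto
qed

lemma larson_set_eq:
  assumes "max_critical_independent G J"
  shows "larson_set G = J \<union> neighborhood G J"
  unfolding larson_set_def
proof (rule the_equality)
  show "is_larson_set G (J \<union> neighborhood G J)" by (rule is_larson_set_closure[OF assms])
  show "L = J \<union> neighborhood G J" if "is_larson_set G L" for L
    using that assms unfolding is_larson_set_def by blast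
qed

section \<open>Core and corona across Larson's decomposition\<close>

text \<open>Passing from \<open>G\<close> to the part outside its Larson set preserves \<open>\<bar>corona\<bar> + \<bar>core\<bar> - 2\<alpha>\<close>; the terms
  are arranged so as to avoid subtraction of natural numbers.\<close>

theorem corona_core_larson:
  defines "H \<equiv> induced G (verts G - larson_set G)"
  shows "card (corona G) + card (core G) + 2 * alpha H
       = 2 * alpha G + card (corona H) + card (core H)"
proof -
  obtain J where maxJ: "max_critical_independent G J" using max_critical_exists by blast
  define N where "N = neighborhood G J"
  define L where "L = J \<union> N"
  have crit: "critical_independent G J" using maxJ by (simp add: max_critical_independent_def)
  then have J: "independent G J" by (simp add: critical_independent_def)
  have disj: "J \<inter> N = {}" using J by (auto simp: independent_iff_neighborhood N_def)
  have finJ: "finite J" and finN: "finite N"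
    using finite_independent[OF J] finite_neighborhood by (auto simp: N_def)
  have H: "H = induced G (verts G - L)"
    using larson_set_eq[OF maxJ] by (simp add: H_def L_def N_def)
  interpret H: finite_simple_graph H
    unfolding H by unfold_locales (rule simple_graph_induced[OF simple])
  have alpha: "alpha G = card J + alpha H"
    using alpha_critical_split[OF crit] by (simp add: H L_def N_def)
  obtain m where m: "inj_on m N" "m ` N \<subseteq> J" "\<And>b. b \<in> N \<Longrightarrow> {b, m b} \<in> edges G"
    using critical_matching_into[OF crit] unfolding N_def by metis
  have extend: "J \<union> T \<in> Omega G" if "T \<in> Omega H" for T
  proof -
    have T: "independent G T" "T \<subseteq> verts G - L" "card T = alpha H"
      using that by (auto simp: Omega_def H independent_induced)
    then have "independent G (J \<union> T)"
      using independent_Un_outside[OF J] by (auto simp: L_def N_def)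
    moreover have "card (J \<union> T) = card J + card T"
      using T finite_independent finJ by (intro card_Un_disjoint) (auto simp: L_def)
    ultimately show ?thesis using T alpha by (simp add: Omega_def)
  qed
  have restrict: "S - L \<in> Omega H" "m ` (S \<inter> N) = J - S" if "S \<in> Omega G" for S
  proof -
    have S: "independent G S" "card S = alpha G" using that by (auto simp: Omega_def)
    have fin: "finite S" using finite_independent[OF S(1)] .
    have i: "independent H (S - L)"
      using S(1) independent_iff_neighborhood[of G S]
      by (auto simp: H independent_induced intro: independent_subset)
    have "m b \<notin> S" if "b \<in> S \<inter> N" for b
      using m(3)[of b] S(1) that by (auto simp: independent_def)
    then have le: "m ` (S \<inter> N) \<subseteq> J - S" using m(2) by auto
    have c: "card (m ` (S \<inter> N)) = card (S \<inter> N)"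
      using m(1) by (intro card_image) (auto intro: inj_on_subset)
    have "card (S \<inter> N) \<le> card (J - S)"
      using card_mono[OF _ le] finJ c by simp
    moreover have "card J = card (J \<inter> S) + card (J - S)" using finJ by (rule card_Int_Diff)
    moreover have "card S = card (S \<inter> J) + card (S \<inter> N) + card (S - L)"
    proof -
      have "S = (S \<inter> J) \<union> (S \<inter> N) \<union> (S - L)" by (auto simp: L_def)
      also have "card \<dots> = card (S \<inter> J) + card (S \<inter> N) + card (S - L)"
        using fin disj by (subst card_Un_disjoint, auto simp: L_def card_Un_disjoint)+
      finally show ?thesis .
    qed
    moreover have "card (S - L) \<le> alpha H" by (rule H.card_le_alpha[OF i])
    \<comment> \<open>The two parts of \<open>S\<close> are at most \<open>\<bar>J\<bar>\<close> and \<open>alpha H\<close>, and these add up to \<open>alpha G\<close>,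
      so both bounds are attained.\<close>
    ultimately have "card (S - L) = alpha H" "card (S \<inter> N) = card (J - S)"
      using S(2) alpha by (simp_all add: Int_commute)
    then show "S - L \<in> Omega H" "m ` (S \<inter> N) = J - S"
      using i c card_subset_eq[OF _ le] finJ by (auto simp: Omega_def)
  qed
  obtain T0 where T0: "T0 \<in> Omega H" using H.Omega_nonempty by blast
  have T_sub: "T \<inter> L = {}" if "T \<in> Omega H" for T
    using that by (auto simp: Omega_def H independent_induced)
  have corona_out: "corona G - L = corona H"
    using extend restrict(1) T_sub unfolding corona_def by blast
  have core_out: "core G - L = core H"
  proof (intro equalityI subsetI)
    fix x assume "x \<in> core G - L"
    then show "x \<in> core H" using extend by (fastforce simp: core_def L_def)
  next
    fix x assume x: "x \<in> core H"
    then have "x \<notin> L" using T0 T_sub by (auto simp: core_def)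
    then show "x \<in> core G - L" using x restrict(1) by (fastforce simp: core_def)
  qed
  have corona_in: "corona G \<inter> L = J \<union> (corona G \<inter> N)"
    using extend[OF T0] by (auto simp: corona_def L_def)
  have "core G \<inter> N = {}"
    using extend[OF T0] T_sub[OF T0] disj by (auto simp: core_def L_def)
  moreover have "J - core G = m ` (corona G \<inter> N)"
  proof -
    have "J - core G = (\<Union>S\<in>Omega G. J - S)" by (auto simp: core_def)
    also have "\<dots> = (\<Union>S\<in>Omega G. m ` (S \<inter> N))" using restrict(2) by simp
    also have "\<dots> = m ` (corona G \<inter> N)" by (auto simp: corona_def)
    finally show ?thesis .
  qed
  ultimately have core_in: "core G \<inter> L = J - m ` (corona G \<inter> N)" by (auto simp: L_def)
  have cm: "card (m ` (corona G \<inter> N)) = card (corona G \<inter> N)"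
    using m(1) by (intro card_image) (auto intro: inj_on_subset)
  have msub: "m ` (corona G \<inter> N) \<subseteq> J" using m(2) by auto
  have "card (corona G \<inter> L) = card J + card (corona G \<inter> N)"
    unfolding corona_in using finJ finN disj by (intro card_Un_disjoint) auto
  moreover have "card (core G \<inter> L) + card (corona G \<inter> N) = card J"
    unfolding core_in using msub finJ cm
    by (metis card_Diff_subset card_mono finite_subset le_add_diff_inverse2)
  ultimately have inside: "card (corona G \<inter> L) + card (core G \<inter> L) = 2 * card J" by simp
  have "finite (corona G)"
    unfolding corona_def using finite_verts
    by (rule finite_subset[rotated]) (auto simp: Omega_def independent_def)
  moreover from this have "finite (core G)"
    by (rule rev_finite_subset) (use extend[OF T0] in \<open>auto simp: core_def corona_def\<close>)
  ultimately have "card (corona G) = card (corona G \<inter> L) + card (corona H)"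
    "card (core G) = card (core G \<inter> L) + card (core H)"
    using card_Int_Diff[of "corona G" L] card_Int_Diff[of "core G" L] corona_out core_out by auto
  then show ?thesis using alpha inside by simp
qed

end

section \<open>Paths and ears\<close>

lemma path_edges_Cons: "path_edges (x # y # p) = insert {x, y} (path_edges (y # p))"
proof -
  have "{i. Suc i < length (x # y # p)} = insert 0 (Suc ` {i. Suc i < length (y # p)})"
    by (auto simp: image_iff gr0_conv_Suc less_Suc_eq_0_disj)
  moreover have path_edges_image: "path_edges q = (\<lambda>i. {q ! i, q ! Suc i}) ` {i. Suc i < length q}"
    for q :: "'a list"
    by (auto simp: path_edges_def)
  ultimately show ?thesis by (simp add: image_image)
qed

lemma path_edges_tl: "path_edges (tl p) \<subseteq> path_edges p"
proof (cases p)
  case (Cons x q)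
  then show ?thesis by (cases q) (auto simp: path_edges_Cons path_edges_def[of "[]"])
qed simp

lemma path_edges_butlast: "path_edges (butlast p) \<subseteq> path_edges p"
  by (fastforce simp: path_edges_def nth_butlast)

lemma card_Int_path:
  assumes "distinct p" "\<forall>e\<in>path_edges p. \<not> e \<subseteq> S"
  shows "2 * card (S \<inter> set p) \<le> length p + 1"
  using assms
proof (induction p rule: induct_list012)
  case (2 x)
  have "card (S \<inter> {x}) \<le> card {x}" by (intro card_mono) auto
  then show ?case by simp
next
  case (3 x y zs)
  have "path_edges zs \<subseteq> path_edges (x # y # zs)"
    using path_edges_tl[of "y # zs"] by (auto simp: path_edges_Cons)
  then have IH: "2 * card (S \<inter> set zs) \<le> length zs + 1" using 3 by (intro "3.IH"(1)) auto
  have "card (S \<inter> {x, y}) \<le> 1"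
  proof -
    have "\<not> {x, y} \<subseteq> S" using "3.prems"(2) by (simp add: path_edges_Cons)
    then have "S \<inter> {x, y} \<subseteq> {x} \<or> S \<inter> {x, y} \<subseteq> {y}" by auto
    then show ?thesis using card_mono[of "{x}"] card_mono[of "{y}"] by auto
  qed
  moreover have "S \<inter> set (x # y # zs) = (S \<inter> {x, y}) \<union> (S \<inter> set zs)" by auto
  ultimately show ?case using IH card_Un_le[of "S \<inter> {x, y}" "S \<inter> set zs"] by simp
qed simp

lemma is_ear_decompose:
  assumes "is_ear H p"
  obtains x q y where "p = x # q @ [y]" "distinct q" "x \<in> verts H" "y \<in> verts H"
    "set q \<inter> verts H = {}" "path_edges q \<subseteq> path_edges p"
proof -
  obtain x p' where p': "p = x # p'" "p' \<noteq> []"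
    using assms by (cases p; cases "tl p") (auto simp: is_ear_def)
  then obtain q y where p: "p = x # q @ [y]" by (cases p' rule: rev_cases) auto
  have "path_edges q \<subseteq> path_edges p"
    using path_edges_tl[of p] path_edges_butlast[of "tl p"] p by simp
  moreover have ends: "set p \<inter> verts H = {x, y}" and "distinct p"
    using assms p by (auto simp: is_ear_def)
  moreover from this have "set q \<inter> {x, y} = {}" "distinct q" using p by auto
  moreover from ends have "x \<in> verts H" "y \<in> verts H" by blast+
  moreover have "set q \<subseteq> set p" using p by auto
  ultimately show thesis by (intro that[OF p]) blast+
qed

text \<open>If \<open>F\<close> has a perfect matching that contains \<open>uv\<close>, an independent set has at most one vertex in
  each of the \<open>\<bar>V(F)\<bar>/2 - 1\<close> other matching edges, which is the stated inequality. Carrying the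
  inequality itself through the induction spares the matching: a new odd ear has an even number
  \<open>2j\<close> of inner vertices, forming a path, of which an independent set contains at most \<open>j\<close>.
  Keeping \<open>S \<inter> {u, v}\<close> as a separate term is what allows the pair \<open>u, v\<close> to be counted later as
  part of the odd cycle.\<close>

lemma odd_ear_sequence_bound:
  assumes "odd_ear_sequence (UGraph {u, v} {{u, v}}) H" "u \<noteq> v"
  shows "finite (verts H) \<and> {u, v} \<subseteq> verts H \<and> {u, v} \<in> edges H \<and>
    (\<forall>S. (\<forall>e\<in>edges H. \<not> e \<subseteq> S) \<longrightarrow>
       2 * card (S \<inter> verts H) + 2 \<le> 2 * card (S \<inter> {u, v}) + card (verts H))"
  using assms
proof (induction rule: odd_ear_sequence.induct)
  case start
  then show ?case by auto
next
  case (step H p)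
  obtain x q y where p: "p = x # q @ [y]" "distinct q" "x \<in> verts H" "y \<in> verts H"
    "set q \<inter> verts H = {}" "path_edges q \<subseteq> path_edges p"
    using is_ear_decompose[OF step.hyps(2)] .
  have IH: "finite (verts H)" "{u, v} \<subseteq> verts H" "{u, v} \<in> edges H"
    "\<And>S. \<forall>e\<in>edges H. \<not> e \<subseteq> S \<Longrightarrow>
       2 * card (S \<inter> verts H) + 2 \<le> 2 * card (S \<inter> {u, v}) + card (verts H)"
    using step.IH[OF step.prems] by auto
  have V: "verts (add_ear H p) = verts H \<union> set q" using p by (auto simp: add_ear_def)
  have cV: "card (verts (add_ear H p)) = card (verts H) + length q"
    unfolding V using IH(1) p by (subst card_Un_disjoint) (auto simp: distinct_card)
  have even: "even (length q)" using step.hyps(3) p(1) by (simp add: path_length_def)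
  have "2 * card (S \<inter> verts (add_ear H p)) + 2
      \<le> 2 * card (S \<inter> {u, v}) + card (verts (add_ear H p))"
    if S: "\<forall>e\<in>edges (add_ear H p). \<not> e \<subseteq> S" for S
  proof -
    have "2 * card (S \<inter> set q) \<le> length q + 1"
      using S p by (intro card_Int_path) (auto simp: add_ear_def)
    then have "2 * card (S \<inter> set q) \<le> length q" using even by presburger
    moreover have "2 * card (S \<inter> verts H) + 2 \<le> 2 * card (S \<inter> {u, v}) + card (verts H)"
      using S by (intro IH(4)) (auto simp: add_ear_def)
    moreover have "card (S \<inter> verts (add_ear H p)) \<le> card (S \<inter> verts H) + card (S \<inter> set q)"
      unfolding V Int_Un_distrib by (rule card_Un_le)
    ultimately show ?thesis using cV by simp
  qed
  then show ?case using IH(1-3) by (auto simp: add_ear_def)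
qed

section \<open>Almost-bipartite matching covered graphs\<close>

text \<open>The graph consists of the bipartite part \<open>F\<close> with equal sides \<open>A\<close>, \<open>B\<close> and the final ear
  \<open>P\<close> with \<open>2k\<close> edges, whose ends \<open>u\<close>, \<open>v\<close> are adjacent in \<open>F\<close>. Positions on the ear are counted from
  \<open>0\<close>; \<open>Ev\<close> and \<open>Od\<close> are its inner vertices at even and at odd positions.\<close>

theorem almost_bipartite_matching_covered_Omega:
  assumes simple: "simple_graph H" and "almost_bipartite_matching_covered H"
  shows "card (verts H) = 2 * alpha H + 1" "corona H = verts H" "core H = {}"
proof -
  interpret finite_simple_graph H by unfold_locales (rule simple)
  obtain u v F P where uv: "u \<noteq> v" and seq: "odd_ear_sequence (UGraph {u, v} {{u, v}}) F"
    and bip: "bipartite F" and ear: "is_ear F P" and even: "even (path_length P)"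
    and ends: "set P \<inter> verts F = {u, v}" and H: "H = add_ear F P"
    using assms(2) unfolding almost_bipartite_matching_covered_def is_K2_def by force
  have F: "finite (verts F)" "{u, v} \<subseteq> verts F" "{u, v} \<in> edges F"
    and bound: "\<And>S. \<forall>e\<in>edges F. \<not> e \<subseteq> S \<Longrightarrow>
       2 * card (S \<inter> verts F) + 2 \<le> 2 * card (S \<inter> {u, v}) + card (verts F)"
    using odd_ear_sequence_bound[OF seq uv] by auto
  obtain A B where AB: "A \<union> B = verts F" "A \<inter> B = {}"
    "\<forall>e\<in>edges F. \<exists>a\<in>A. \<exists>b\<in>B. e = {a, b}"
    using bip unfolding bipartite_def by blast
  have edge_F: "e \<subseteq> verts F" if "e \<in> edges F" for e using that AB(1,3) by fastforce
  have free: "\<forall>e\<in>edges F. \<not> e \<subseteq> A" "\<forall>e\<in>edges F. \<not> e \<subseteq> B" using AB(2,3) by fastforce+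
  have uvA: "card (A \<inter> {u, v}) = 1" and uvB: "card (B \<inter> {u, v}) = 1"
  proof -
    obtain a b where "a \<in> A" "b \<in> B" "{u, v} = {a, b}" using AB(3) F(3) by blast
    then have "A \<inter> {u, v} = {a}" "B \<inter> {u, v} = {b}" using AB(2) by auto
    then show "card (A \<inter> {u, v}) = 1" "card (B \<inter> {u, v}) = 1" by auto
  qed
  have finAB: "finite A" "finite B" using F(1) AB(1) by (metis finite_Un)+
  \<comment> \<open>Each side is independent and contains exactly one of \<open>u\<close>, \<open>v\<close>, so by the bound neither exceeds
    half of the vertices.\<close>
  have cAB: "2 * card A = card (verts F)" "2 * card B = card (verts F)"
  proof -
    have "A \<inter> verts F = A" "B \<inter> verts F = B" using AB(1) by auto
    then have "2 * card A \<le> card (verts F)" "2 * card B \<le> card (verts F)"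
      using bound[OF free(1)] bound[OF free(2)] uvA uvB by auto
    moreover have "card A + card B = card (verts F)"
      using card_Un_disjoint[OF finAB AB(2)] AB(1) by simp
    ultimately show "2 * card A = card (verts F)" "2 * card B = card (verts F)" by auto
  qed
  obtain k where k: "length P = 2 * k + 1" "1 \<le> k"
  proof -
    have "2 \<le> length P" using ear by (simp add: is_ear_def)
    moreover from this have "odd (length P)" using even by (cases P) (auto simp: path_length_def)
    ultimately show thesis using that by (elim oddE) auto
  qed
  have dist: "distinct P" using ear by (simp add: is_ear_def)
  have "P \<noteq> []" using k by auto
  then have hd_last: "P ! 0 = hd P" "P ! (2 * k) = last P"
    using k(1) by (auto simp: hd_conv_nth last_conv_nth)
  then have Pends: "{P ! 0, P ! (2 * k)} = {u, v}"
    using ear ends by (simp add: is_ear_def)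
  have nth_mem: "P ! i \<in> (!) P ` I \<longleftrightarrow> i \<in> I" if "i \<le> 2 * k" "I \<subseteq> {..2 * k}" for i I
    using that k dist by (intro inj_on_image_mem_iff[of _ "{..2 * k}"])
      (auto simp: inj_on_def nth_eq_iff_index_eq)
  have set_P: "set P = (!) P ` {..2 * k}" using k(1) by (auto simp: set_conv_nth)
  have nth_F: "i = 0 \<or> i = 2 * k" if "i \<le> 2 * k" "P ! i \<in> verts F" for i
  proof -
    have "P ! i \<in> (!) P ` {0, 2 * k}" using that ends Pends set_P by auto
    then show ?thesis using nth_mem[of i "{0, 2 * k}"] that by auto
  qed
  define Ev where "Ev = (!) P ` ((\<lambda>j. 2 * j) ` {1..<k})"
  define Od where "Od = (!) P ` ((\<lambda>j. 2 * j + 1) ` {..<k})"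
  have nth_Ev: "even i \<and> 0 < i \<and> i < 2 * k \<longleftrightarrow> P ! i \<in> Ev" if "i \<le> 2 * k" for i
    using that unfolding Ev_def by (subst nth_mem) (auto elim!: evenE)
  have nth_Od: "odd i \<longleftrightarrow> P ! i \<in> Od" if "i \<le> 2 * k" for i
    using that unfolding Od_def by (subst nth_mem) (auto elim!: oddE)
  have inj_P: "inj_on ((!) P) {..2 * k}"
    using k(1) dist by (auto simp: inj_on_def nth_eq_iff_index_eq)
  have "card Ev = card ((\<lambda>j. 2 * j) ` {1..<k})"
    unfolding Ev_def by (intro card_image inj_on_subset[OF inj_P]) auto
  also have "\<dots> = k - 1" by (subst card_image) (auto simp: inj_on_def)
  finally have cEv: "card Ev = k - 1" .
  have "card Od = card ((\<lambda>j. 2 * j + 1) ` {..<k})"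
    unfolding Od_def by (intro card_image inj_on_subset[OF inj_P]) auto
  also have "\<dots> = k" by (subst card_image) (auto simp: inj_on_def)
  finally have cOd: "card Od = k" .
  have fin_EO: "finite Ev" "finite Od" by (auto simp: Ev_def Od_def)
  have Ev_sub: "Ev \<subseteq> set P" and Od_sub: "Od \<subseteq> set P" by (auto simp: Ev_def Od_def set_P)
  have disj_Ev: "Ev \<inter> verts F = {}"
  proof -
    have "P ! i \<notin> verts F" if "i \<le> 2 * k" "P ! i \<in> Ev" for i
      using nth_F[OF that(1)] nth_Ev[OF that(1)] that(2) by auto
    then show ?thesis using Ev_sub unfolding set_P by blast
  qed
  have disj_Od: "Od \<inter> verts F = {}"
  proof -
    have "P ! i \<notin> verts F" if "i \<le> 2 * k" "P ! i \<in> Od" for i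
      using nth_F[OF that(1)] nth_Od[OF that(1)] that(2) by auto
    then show ?thesis using Od_sub unfolding set_P by blast
  qed
  have disj_EO: "Ev \<inter> Od = {}"
  proof -
    have "P ! i \<notin> Od" if "i \<le> 2 * k" "P ! i \<in> Ev" for i
      using nth_Od[OF that(1)] nth_Ev[OF that(1)] that(2) by auto
    then show ?thesis using Ev_sub unfolding set_P by blast
  qed
  have V: "verts H = verts F \<union> Ev \<union> Od"
  proof -
    have "P ! i \<in> verts F \<union> Ev \<union> Od" if "i \<le> 2 * k" for i
    proof -
      have "i = 0 \<or> i = 2 * k \<or> odd i \<or> even i \<and> 0 < i \<and> i < 2 * k" using that by auto
      moreover have "P ! 0 \<in> verts F" "P ! (2 * k) \<in> verts F" using Pends F(2) by blast+
      ultimately show ?thesis using nth_Od[OF that] nth_Ev[OF that] by auto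
    qed
    then have "set P \<subseteq> verts F \<union> Ev \<union> Od" using set_P by auto
    then show ?thesis using Ev_sub Od_sub by (auto simp: H add_ear_def)
  qed
  have cV: "card (verts H) = card (verts F) + (k - 1) + k"
  proof -
    have "(verts F \<union> Ev) \<inter> Od = {}" "verts F \<inter> Ev = {}" using disj_Ev disj_Od disj_EO by auto
    then show ?thesis unfolding V using F(1) fin_EO cEv cOd by (simp add: card_Un_disjoint)
  qed
  have E: "edges H = edges F \<union> path_edges P" by (simp add: H add_ear_def)
  \<comment> \<open>The bound limits the vertices of \<open>S\<close> outside the odd cycle formed by the ear and \<open>uv\<close>;
    the cycle itself contains at most \<open>k\<close> vertices of \<open>S\<close>, because one of \<open>u\<close>, \<open>v\<close> is missing from \<open>S\<close> and
    deleting that vertex leaves a path on \<open>2k\<close> vertices.\<close>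
  have upper: "2 * card S \<le> card (verts F) + 2 * (k - 1)" if S: "independent H S" for S
  proof -
    have no_edge: "\<forall>e\<in>edges H. \<not> e \<subseteq> S" and sub: "S \<subseteq> verts F \<union> set P"
      using S Ev_sub Od_sub by (auto simp: independent_iff_edges V)
    have b: "2 * card (S \<inter> verts F) + 2 \<le> 2 * card (S \<inter> {u, v}) + card (verts F)"
      using no_edge E by (intro bound) blast
    have cyc: "card (S \<inter> set P) \<le> k"
    proof -
      have lens: "length (tl P) = 2 * k" "length (butlast P) = 2 * k" using k by auto
      have "{hd P, last P} \<in> edges H" using F(3) E Pends hd_last by simp
      then have "\<not> {hd P, last P} \<subseteq> S" using no_edge by blast
      then consider "hd P \<notin> S" | "last P \<notin> S" by auto
      then show ?thesis
      proof cases
        case 1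
        have "2 * card (S \<inter> set (tl P)) \<le> length (tl P) + 1"
          using no_edge E path_edges_tl[of P] dist by (intro card_Int_path distinct_tl) blast+
        moreover have "set P = insert (hd P) (set (tl P))" using \<open>P \<noteq> []\<close> by (cases P) auto
        then have "S \<inter> set P = S \<inter> set (tl P)" using 1 by auto
        ultimately show ?thesis using lens by simp
      next
        case 2
        have "2 * card (S \<inter> set (butlast P)) \<le> length (butlast P) + 1"
          using no_edge E path_edges_butlast[of P] dist
          by (intro card_Int_path distinct_butlast) blast+
        moreover have "set P = insert (last P) (set (butlast P))"
          using \<open>P \<noteq> []\<close> by (cases P rule: rev_cases) auto
        then have "S \<inter> set P = S \<inter> set (butlast P)" using 2 by auto
        ultimately show ?thesis using lens by simp
      qed
    qed
    have "S = (S \<inter> verts F) \<union> (S \<inter> set P)" using sub by auto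
    moreover have "(S \<inter> verts F) \<inter> (S \<inter> set P) = S \<inter> {u, v}" using ends by auto
    ultimately have "card S + card (S \<inter> {u, v}) = card (S \<inter> verts F) + card (S \<inter> set P)"
      using F(1) card_Un_Int[of "S \<inter> verts F" "S \<inter> set P"] by simp
    then show ?thesis using b cyc k(2) by simp
  qed
  \<comment> \<open>Consecutive positions have different parity. The ends of the ear have the even
    positions \<open>0\<close> and \<open>2k\<close>, so a side of \<open>F\<close> can be joined with \<open>Ev\<close>, but has to lose its end before
    it is joined with \<open>Od\<close>.\<close>
  have no_path_edge: "\<not> e \<subseteq> W"
    if e: "e \<in> path_edges P"
      and parity: "(\<forall>i\<le>2 * k. P ! i \<in> W \<longrightarrow> even i) \<or> (\<forall>i\<le>2 * k. P ! i \<in> W \<longrightarrow> odd i)"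
    for e W
  proof -
    obtain i where i: "e = {P ! i, P ! Suc i}" "Suc i < length P"
      using e unfolding path_edges_def by blast
    then have i_le: "Suc i \<le> 2 * k" using k(1) by simp
    show ?thesis
    proof
      assume "e \<subseteq> W"
      then have "P ! i \<in> W" "P ! Suc i \<in> W" using i by auto
      then have "even i \<and> even (Suc i) \<or> odd i \<and> odd (Suc i)"
        using parity i_le Suc_leD by blast
      then show False by simp
    qed
  qed
  have side: "independent H (X \<union> Ev) \<and> 2 * card (X \<union> Ev) = card (verts F) + 2 * (k - 1)"
    if X: "X \<subseteq> verts F" "\<forall>e\<in>edges F. \<not> e \<subseteq> X" "2 * card X = card (verts F)" for X
  proof
    have "\<not> e \<subseteq> X \<union> Ev" if "e \<in> edges F" for e
      using that edge_F[OF that] X(2) disj_Ev by blast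
    moreover have "even i" if i: "i \<le> 2 * k" "P ! i \<in> X \<union> Ev" for i
    proof -
      have "P ! i \<in> verts F \<or> P ! i \<in> Ev" using i(2) X(1) by blast
      then show ?thesis using nth_F[OF i(1)] nth_Ev[OF i(1)] by auto
    qed
    ultimately have "\<forall>e\<in>edges H. \<not> e \<subseteq> X \<union> Ev" using no_path_edge E by blast
    then show "independent H (X \<union> Ev)" using X(1) V unfolding independent_iff_edges by blast
    show "2 * card (X \<union> Ev) = card (verts F) + 2 * (k - 1)"
      using X F(1) fin_EO disj_Ev cEv by (subst card_Un_disjoint) (auto intro: finite_subset)
  qed
  let ?S = "(A - {u, v}) \<union> Od"
  have third: "independent H ?S \<and> 2 * card ?S = card (verts F) + 2 * (k - 1)"
  proof
    have AF: "A \<subseteq> verts F" using AB(1) by auto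
    have "\<not> e \<subseteq> ?S" if "e \<in> edges F" for e
      using that edge_F[OF that] free(1) disj_Od by blast
    moreover have "odd i" if i: "i \<le> 2 * k" "P ! i \<in> ?S" for i
    proof
      assume "even i"
      then have "P ! i \<in> A - {u, v}" using i nth_Od by auto
      then have "P ! i \<in> verts F \<and> P ! i \<notin> {u, v}" using AF by auto
      then show False using nth_F[OF i(1)] Pends by auto
    qed
    ultimately have "\<forall>e\<in>edges H. \<not> e \<subseteq> ?S" using no_path_edge E by blast
    then show "independent H ?S" using AF V unfolding independent_iff_edges by blast
    have "card A = card (A \<inter> {u, v}) + card (A - {u, v})" using finAB(1) by (rule card_Int_Diff)
    then have "card (A - {u, v}) + 1 = card A" using uvA by simp
    moreover have "card ?S = card (A - {u, v}) + k"
      using finAB fin_EO disj_Od AF cOd by (subst card_Un_disjoint) auto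
    ultimately show "2 * card ?S = card (verts F) + 2 * (k - 1)" using cAB(1) k(2) by linarith
  qed
  have sideA: "independent H (A \<union> Ev) \<and> 2 * card (A \<union> Ev) = card (verts F) + 2 * (k - 1)"
    and sideB: "independent H (B \<union> Ev) \<and> 2 * card (B \<union> Ev) = card (verts F) + 2 * (k - 1)"
    using side[of A] side[of B] free cAB AB(1) by auto
  have alpha: "2 * alpha H = card (verts F) + 2 * (k - 1)"
    using alpha_eqI[of "A \<union> Ev"] sideA upper by fastforce
  have mem: "S \<in> Omega H" if "independent H S \<and> 2 * card S = card (verts F) + 2 * (k - 1)" for S
    using that alpha by (simp add: Omega_def)
  note Om = mem[OF sideA] mem[OF sideB] mem[OF third]
  show "card (verts H) = 2 * alpha H + 1" using cV alpha k(2) by simp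
  have "verts H \<subseteq> corona H"
    using Om AB(1) unfolding V corona_def by blast
  moreover have "corona H \<subseteq> verts H" by (auto simp: corona_def Omega_def independent_def)
  ultimately show "corona H = verts H" by blast
  have "core H \<subseteq> (A \<union> Ev) \<inter> (B \<union> Ev) \<inter> ?S" using Om unfolding core_def by blast
  also have "\<dots> = {}" using AB(1,2) disj_EO disj_Ev by blast
  finally show "core H = {}" by simp
qed

theorem theorem4p7:
  fixes G :: "'a ugraph"
  assumes "simple_graph G"
    and "almost_bipartite_matching_covered (induced G (verts G - larson_set G))"
  shows "card (corona G) + card (core G) = 2 * alpha G + 1"
proof -
  interpret finite_simple_graph G by unfold_locales (rule assms(1))
  show ?thesis
    using corona_core_larson
      almost_bipartite_matching_covered_Omega[OF simple_graph_induced[OF assms(1)] assms(2)]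
    by simp
qed

end
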